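(* Let $f:\mathbb{R}^n\to\mathbb{R}$ be continuously differentiable, convex, with global minimum value $f_{\mathrm{low}}:=\min_{x\in\mathbb{R}^n}f(x)$ attained at a minimizer $x^*$, and assume there exists $R\ge1$ such that $\|x-x^*\|\le R$ for all $x$ with $f(x)\le f(x_0)$. Consider a run of the trust-region algorithm described in the context. Assume there is $L\ge 1$ with $|f(x_k+s_k)-m_k(s_k)|\le \tfrac12(L+\|B_k\|)\|s_k\|^2$ for all $k\in\mathbb{N}$, and that there exist $\mu>0$ and $0\le p\le 1$ such that $\max_{j=0,\ldots,k}\|B_j\|\le \mu(1+|\mathcal{S}_{k-1}|^p)$ for all $k\in\mathbb{N}$. Assume that the algorithm generates infinitely many successful iterations. Define $$\kappa_0:=\frac{\psi_\beta(2\mu)}{\eta_1\kappa_{\mathrm{mdc}}a_{\min}},\qquad \kappa_2:=\frac{\psi_\beta(2\mu)}{\psi_\beta(\mu)}.$$ Let $\delta_k:=f(x_k)-f_{\mathrm{low}}$, let $\epsilon>0$, let $\widehat{k}_\epsilon$ be the first iteration such that $\delta_{\widehat{k}_\epsilon}>\epsilon$ and $\delta_{\widehat{k}_\epsilon+1}\le\epsilon$, and let $\widehat{\mathcal{S}}(\epsilon):=\{k\in\mathcal{S}\mid k<\widehat{k}_\epsilon\}$. If $p=0$, then $|\widehat{\mathcal{S}}(\epsilon)|\le R^2\kappa_0\,\epsilon^{-1}=O(\epsilon^{-1})$. If $0<p<1$, then $$|\widehat{\mathcal{S}}(\epsilon)|\le\left[(1-p)(R^2\kappa_0\,\epsilon^{-1}-\kappa_2)+1\right]^{1/(1-p)}=O\left([(1-p)\epsilon^{-1}]^{1/(1-p)}\right).$$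 If $p=1$, then $|\widehat{\mathcal{S}}(\epsilon)|\le\exp(R^2\kappa_0\,\epsilon^{-1}-\kappa_2)$.
   Context: $\|\cdot\|$ is the Euclidean norm for vectors and the induced norm for matrices; $\mathbb{N}=\{0,1,2,\ldots\}$; by convention $0^0=1$; $|\mathcal A|$ is the cardinality of a finite set. Trust-region algorithm. Fix constants $0<\eta_1\le\eta_2<1$, $0<\gamma_1\le\gamma_2<1\le\gamma_3\le\gamma_4$, $0<\kappa_{\mathrm{mdc}}\le\frac12$, $-1\le\alpha\le1$, $0\le\beta\le1$, $x_0\in\mathbb{R}^n$, $\Delta_0>0$. For $k=0,1,\ldots$: choose a symmetric $B_k\in\mathbb{R}^{n\times n}$ and set $m_k(s):=f(x_k)+\nabla f(x_k)^Ts+\frac12 s^TB_ks$ and $r_k:=\frac{\|\nabla f(x_k)\|^\alpha}{(1+\|B_k\|)^\beta}\Delta_k$. Let $s_{k,\mathrm{cp}}:=-t_k\nabla f(x_k)$, where $t_k$ minimizes $m_k(-t\nabla f(x_k))$ over $t\ge0$ with $\|t\nabla f(x_k)\|\le r_k$. Compute any $s_k$ with $\|s_k\|\le r_k$ and $m_k(0)-m_k(s_k)\ge2\kappa_{\mathrm{mdc}}(m_k(0)-m_k(s_{k,\mathrm{cp}}))$. Let $\rho_k:=\frac{f(x_k)-f(x_k+s_k)}{m_k(0)-m_k(s_k)}$. If $\rho_k\ge\eta_1$, set $x_{k+1}:=x_k+s_k$; otherwise $x_{k+1}:=x_k$. Choose $\Delta_{k+1}\in[\gamma_3\Delta_k,\gamma_4\Delta_k]$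 if $\rho_k\ge\eta_2$; $\Delta_{k+1}\in[\gamma_2\Delta_k,\Delta_k]$ if $\eta_1\le\rho_k<\eta_2$; $\Delta_{k+1}\in[\gamma_1\Delta_k,\gamma_2\Delta_k]$ if $\rho_k<\eta_1$. Iteration $i$ is successful if $\rho_i\ge\eta_1$; $\mathcal{S}:=\{i\in\mathbb{N}\mid\rho_i\ge\eta_1\}$, $\mathcal{S}_k:=\{i\in\mathcal{S}\mid i\le k\}$, and $|\mathcal{S}_{-1}|:=0$. $a_{\min}:=2\gamma_1\kappa_{\mathrm{mdc}}(1-\eta_2)\min\left\{1,\frac{\Delta_0}{\|\nabla f(x_0)\|^{1-\alpha}}\right\}$. For $x\ge0$, $\psi_\beta(x):=L+x$ if $\beta\in[0,1/L]$ and $\psi_\beta(x):=L(1+x)$ if $\beta\in(1/L,1]$. The $O(\cdot)$ notation refers to $\epsilon\to0$. *)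

theory Defs
  imports "HOL-Analysis.Analysis" "HOL-Library.Landau_Symbols"
begin

text \<open>Real powers with \<open>0\<^sup>0 = 1\<close>; the library has \<open>0 powr 0 = 0\<close>.\<close>

definition rpow :: "real \<Rightarrow> real \<Rightarrow> real" where
  "rpow x a = (if a = 0 then 1 else x powr a)"

text \<open>The norm of the type \<open>real^'n^'n\<close> is the Frobenius norm, hence the use of \<open>onorm\<close>.\<close>

definition mat_norm :: "real^'n^'n \<Rightarrow> real" where
  "mat_norm A = onorm (\<lambda>v. A *v v)"

text \<open>In what follows \<open>g\<close> stands for the gradient map of \<open>f\<close>.\<close>

definition model ::
  "(real^'n \<Rightarrow> real) \<Rightarrow> (real^'n \<Rightarrow> real^'n) \<Rightarrow> real^'n \<Rightarrow> real^'n^'n \<Rightarrow> real^'n \<Rightarrow> real" where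
  "model f g x B s = f x + g x \<bullet> s + 1/2 * (s \<bullet> (B *v s))"

definition tr_radius ::
  "(real^'n \<Rightarrow> real^'n) \<Rightarrow> real \<Rightarrow> real \<Rightarrow> real^'n \<Rightarrow> real^'n^'n \<Rightarrow> real \<Rightarrow> real" where
  "tr_radius g \<alpha> \<beta> x B \<Delta> = rpow (norm (g x)) \<alpha> / rpow (1 + mat_norm B) \<beta> * \<Delta>"

text \<open>If the model decrease is \<open>0\<close>, which can only happen for \<open>g x = 0\<close> in a run of the
  algorithm, the ratio is \<open>0\<close> and the iteration counts as unsuccessful.\<close>

definition tr_ratio ::
  "(real^'n \<Rightarrow> real) \<Rightarrow> (real^'n \<Rightarrow> real^'n) \<Rightarrow> real^'n \<Rightarrow> real^'n^'n \<Rightarrow> real^'n \<Rightarrow> real" where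
  "tr_ratio f g x B s = (f x - f (x + s)) / (model f g x B 0 - model f g x B s)"

text \<open>The sequences of iterates, matrices, Cauchy step lengths, steps and radius parameters
  generated by the algorithm; the initial data are \<open>x 0\<close> and \<open>\<Delta> 0\<close>.\<close>

locale trust_region_run =
  fixes f :: "real^'n \<Rightarrow> real" and g :: "real^'n \<Rightarrow> real^'n"
    and \<eta>1 \<eta>2 \<gamma>1 \<gamma>2 \<gamma>3 \<gamma>4 \<kappa>mdc \<alpha> \<beta> :: real
    and x :: "nat \<Rightarrow> real^'n" and B :: "nat \<Rightarrow> real^'n^'n" and t :: "nat \<Rightarrow> real"
    and s :: "nat \<Rightarrow> real^'n" and \<Delta> :: "nat \<Rightarrow> real"
  assumes eta: "0 < \<eta>1" "\<eta>1 \<le> \<eta>2" "\<eta>2 < 1"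
    and gamma: "0 < \<gamma>1" "\<gamma>1 \<le> \<gamma>2" "\<gamma>2 < 1" "1 \<le> \<gamma>3" "\<gamma>3 \<le> \<gamma>4"
    and kappa_mdc: "0 < \<kappa>mdc" "\<kappa>mdc \<le> 1/2"
    and alpha: "-1 \<le> \<alpha>" "\<alpha> \<le> 1"
    and beta: "0 \<le> \<beta>" "\<beta> \<le> 1"
    and Delta_0: "0 < \<Delta> 0"
    and B_symmetric: "\<And>k. transpose (B k) = B k"
    and cauchy_point: "\<And>k. is_arg_min (\<lambda>\<tau>. model f g (x k) (B k) (- \<tau> *\<^sub>R g (x k)))
          (\<lambda>\<tau>. 0 \<le> \<tau> \<and> norm (\<tau> *\<^sub>R g (x k)) \<le> tr_radius g \<alpha> \<beta> (x k) (B k) (\<Delta> k)) (t k)"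
    and step_bound: "\<And>k. norm (s k) \<le> tr_radius g \<alpha> \<beta> (x k) (B k) (\<Delta> k)"
    and step_decrease: "\<And>k. model f g (x k) (B k) 0 - model f g (x k) (B k) (s k)
          \<ge> 2 * \<kappa>mdc * (model f g (x k) (B k) 0 - model f g (x k) (B k) (- t k *\<^sub>R g (x k)))"
    and iterate_update: "\<And>k. x (Suc k) =
          (if tr_ratio f g (x k) (B k) (s k) \<ge> \<eta>1 then x k + s k else x k)"
    and radius_very_successful: "\<And>k. tr_ratio f g (x k) (B k) (s k) \<ge> \<eta>2 \<Longrightarrow>
          \<Delta> (Suc k) \<in> {\<gamma>3 * \<Delta> k .. \<gamma>4 * \<Delta> k}"
    and radius_successful: "\<And>k. \<eta>1 \<le> tr_ratio f g (x k) (B k) (s k) \<Longrightarrow>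
          tr_ratio f g (x k) (B k) (s k) < \<eta>2 \<Longrightarrow> \<Delta> (Suc k) \<in> {\<gamma>2 * \<Delta> k .. \<Delta> k}"
    and radius_unsuccessful: "\<And>k. tr_ratio f g (x k) (B k) (s k) < \<eta>1 \<Longrightarrow>
          \<Delta> (Suc k) \<in> {\<gamma>1 * \<Delta> k .. \<gamma>2 * \<Delta> k}"

definition successful ::
  "(real^'n \<Rightarrow> real) \<Rightarrow> (real^'n \<Rightarrow> real^'n) \<Rightarrow> real \<Rightarrow> (nat \<Rightarrow> real^'n) \<Rightarrow> (nat \<Rightarrow> real^'n^'n) \<Rightarrow>
    (nat \<Rightarrow> real^'n) \<Rightarrow> nat set" where
  "successful f g \<eta>1 x B s = {i. tr_ratio f g (x i) (B i) (s i) \<ge> \<eta>1}"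

definition psi :: "real \<Rightarrow> real \<Rightarrow> real \<Rightarrow> real" where
  "psi L \<beta> y = (if \<beta> \<le> 1 / L then L + y else L * (1 + y))"

definition a_min :: "real \<Rightarrow> real \<Rightarrow> real \<Rightarrow> real \<Rightarrow> real \<Rightarrow> real^'n \<Rightarrow> real" where
  "a_min \<gamma>1 \<kappa>mdc \<eta>2 \<alpha> \<Delta>0 g0 =
    2 * \<gamma>1 * \<kappa>mdc * (1 - \<eta>2) * min 1 (\<Delta>0 / rpow (norm g0) (1 - \<alpha>))"

text \<open>For a sequence \<open>\<delta>\<close> of optimality gaps: \<open>crosses \<delta> \<epsilon> k\<close> says that the gap drops to the
  tolerance \<open>\<epsilon>\<close> in iteration \<open>k\<close>, and \<open>k_hat \<delta> \<epsilon>\<close> is the first such iteration (only meaningful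
  if there is one).\<close>

definition crosses :: "(nat \<Rightarrow> real) \<Rightarrow> real \<Rightarrow> nat \<Rightarrow> bool" where
  "crosses \<delta> \<epsilon> k \<longleftrightarrow> \<delta> k > \<epsilon> \<and> \<delta> (Suc k) \<le> \<epsilon>"

definition k_hat :: "(nat \<Rightarrow> real) \<Rightarrow> real \<Rightarrow> nat" where
  "k_hat \<delta> \<epsilon> = (LEAST k. crosses \<delta> \<epsilon> k)"

definition S_hat :: "nat set \<Rightarrow> (nat \<Rightarrow> real) \<Rightarrow> real \<Rightarrow> nat set" where
  "S_hat S \<delta> \<epsilon> = {k \<in> S. k < k_hat \<delta> \<epsilon>}"

end

theory Submission
  imports Defs
begin

text \<open>
  Write \<open>\<delta>\<^sub>k\<close> for the optimality gap and \<open>R\<close> for the radius of the initial level set. The iterates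
  never increase \<open>f\<close>, so they stay in that level set, and convexity gives
  \<open>\<delta>\<^sub>k \<le> \<delta>\<^sub>j \<le> R \<parallel>\<nabla>f(x\<^sub>j)\<parallel>\<close> for all \<open>j \<le> k\<close> (\<open>gap_le_gnorm\<close>). The gradient norms themselves
  need not be monotone, but \<open>G = \<delta>\<^sub>k / R\<close> is a lower bound for all of them up to iteration \<open>k\<close>.

  Let \<open>M\<close> bound \<open>\<parallel>B\<^sub>j\<parallel>\<close> for \<open>j \<le> k\<close>. The radius parameter shrinks only if the radius is too large
  for the model error to be negligible against the Cauchy decrease, and this keeps
  \<open>\<Delta>\<^sub>k\<close> above \<open>a\<^sub>m\<^sub>i\<^sub>n G\<^bsup>1 - \<alpha>\<^esup> (1 + M)\<^bsup>\<beta>\<^esup> / \<psi>(M)\<close> (\<open>Delta_lower_bound\<close>). The function \<open>\<psi>\<close> is made for this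
  step: it dominates \<open>L + y\<close>, and \<open>(1 + y)\<^bsup>\<beta>\<^esup> / \<psi>(y)\<close> does not increase with \<open>y\<close>. Consequently a successful
  iteration decreases \<open>f\<close> by at least \<open>\<eta>\<^sub>1 \<kappa>\<^sub>m\<^sub>d\<^sub>c a\<^sub>m\<^sub>i\<^sub>n G\<^sup>2 / \<psi>(M)\<close> (\<open>successful_decrease\<close>).

  The decrease being quadratic in the gap, \<open>1 / \<delta>\<^sub>k\<close> grows by \<open>\<eta>\<^sub>1 \<kappa>\<^sub>m\<^sub>d\<^sub>c a\<^sub>m\<^sub>i\<^sub>n / (R\<^sup>2 \<psi>(M))\<close> in every successful
  iteration. At the success that has \<open>j\<close> predecessors one may take \<open>M = \<mu>(1 + j\<^bsup>p\<^esup>)\<close>, so as long as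
  \<open>\<delta>\<^sub>k > \<epsilon>\<close> the sum of \<open>\<psi>(2\<mu>) / \<psi>(\<mu>(1 + j\<^bsup>p\<^esup>))\<close> over all \<open>j\<close> below the number \<open>n\<close> of successes so far
  is at most \<open>R\<^sup>2 \<kappa>\<^sub>0 / \<epsilon>\<close> (\<open>sum_weights_le\<close>). For \<open>p = 0\<close> every summand is \<open>1\<close>. For \<open>p > 0\<close> the first
  summand is \<open>\<kappa>\<^sub>2\<close> and the others are at least \<open>j\<^bsup>-p\<^esup>\<close> (\<open>sum_weights_ge\<close>); comparing the sum of the
  \<open>j\<^bsup>-p\<^esup>\<close> with an integral and solving for \<open>n\<close> gives the power bound and, for \<open>p = 1\<close>, the exponential one.

  For the asymptotic statements about the number of successes, \<open>\<epsilon>\<close> must actually be reached once it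
  is small: otherwise the same bound would hold for \<open>n\<close> along the whole run, although there are
  infinitely many successes (\<open>eventually_crosses\<close>).
\<close>

section \<open>Auxiliary inequalities\<close>

lemma rpow_eq_powr: "0 < y \<Longrightarrow> rpow y a = y powr a"
  by (simp add: rpow_def)

lemma powr_Bernoulli_le:
  fixes y q :: real
  assumes "0 < y" "0 \<le> q" "q \<le> 1"
  shows "y powr q \<le> 1 + q * (y - 1)"
proof -
  have "y powr q * 1 powr (1 - q) \<le> q * y + (1 - q) * 1"
    using assms by (intro Youngs_inequality_0) auto
  then show ?thesis by (simp add: right_diff_distrib)
qed

text \<open>The left-hand side is the integral of \<open>y\<^bsup>-p\<^esup>\<close> from \<open>1\<close> to \<open>n\<close>. The induction step bounds its increment
  by the Bernoulli inequality instead of integrating.\<close>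

lemma powr_diff_le_sum:
  fixes p :: real
  assumes "0 < p" "p < 1" "1 \<le> n"
  shows "(real n powr (1 - p) - 1) / (1 - p) \<le> (\<Sum>j=1..<n. real j powr (- p))"
  using \<open>1 \<le> n\<close>
proof (induction n rule: nat_induct_at_least)
  case base
  then show ?case by simp
next
  case (Suc n)
  then have n: "0 < real n" by simp
  have "real (Suc n) powr (1 - p) = (real n * (1 + 1 / real n)) powr (1 - p)"
    using n by (simp add: distrib_left add.commute)
  also have "\<dots> = real n powr (1 - p) * (1 + 1 / real n) powr (1 - p)"
    by (simp add: powr_mult)
  also have "\<dots> \<le> real n powr (1 - p) * (1 + (1 - p) * (1 / real n))"
    using powr_Bernoulli_le[of "1 + 1 / real n" "1 - p"] assms n
    by (intro mult_left_mono) (auto simp: add_pos_pos)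
  also have "\<dots> = real n powr (1 - p) + (1 - p) * real n powr (- p)"
    using n by (simp add: powr_diff powr_minus field_simps)
  finally have "(real (Suc n) powr (1 - p) - 1) / (1 - p)
      \<le> (real n powr (1 - p) - 1 + (1 - p) * real n powr (- p)) / (1 - p)"
    using assms by (intro divide_right_mono) auto
  also have "\<dots> = (real n powr (1 - p) - 1) / (1 - p) + real n powr (- p)"
    using assms by (simp add: add_divide_distrib)
  finally have "(real (Suc n) powr (1 - p) - 1) / (1 - p)
      \<le> (real n powr (1 - p) - 1) / (1 - p) + real n powr (- p)" .
  then show ?case using Suc by simp
qed

lemma ln_le_sum_inverse:
  assumes "1 \<le> n"
  shows "ln (real n) \<le> (\<Sum>j=1..<n. inverse (real j))"
  using assms
proof (induction n rule: nat_induct_at_least)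
  case base
  then show ?case by simp
next
  case (Suc n)
  then have n: "0 < real n" by simp
  have "ln (real (Suc n)) = ln (real n * (1 + 1 / real n))"
    using n by (simp add: distrib_left add.commute)
  also have "\<dots> = ln (real n) + ln (1 + 1 / real n)"
    using n by (subst ln_mult_pos) (auto simp: add_pos_pos)
  also have "\<dots> \<le> ln (real n) + inverse (real n)"
    using ln_add_one_self_le_self[of "1 / real n"] n by (simp add: inverse_eq_divide)
  finally show ?case using Suc by simp
qed

text \<open>A decrease quadratic in the gap turns into a linear increase of its reciprocal, because
  \<open>1/b - 1/a = (a - b) / (a b) \<ge> (a - b) / a\<^sup>2\<close>.\<close>

lemma inverse_gap_increase:
  fixes a b c :: real
  assumes "0 < b" "b \<le> a" "c * a\<^sup>2 \<le> a - b"
  shows "inverse a + c \<le> inverse b"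
proof -
  have "c * (a * b) \<le> a - b"
  proof (cases "0 \<le> c")
    case True
    have "c * (a * b) \<le> c * (a * a)"
      using assms True by (intro mult_left_mono) auto
    then show ?thesis using assms(3) by (simp add: power2_eq_square)
  next
    case False
    then have "c * (a * b) \<le> 0" using assms by (intro mult_nonpos_nonneg) auto
    then show ?thesis using assms by simp
  qed
  then show ?thesis using assms by (simp add: field_simps)
qed

lemma convex_above_tangent_plane:
  fixes f :: "'a::real_inner \<Rightarrow> real"
  assumes "GDERIV f y :> d" "convex_on UNIV f"
  shows "f y + d \<bullet> (z - y) \<le> f z"
proof -
  \<comment> \<open>Restricting \<open>f\<close> to the line through \<open>y\<close> and \<open>z\<close> reduces this to the tangent of a convex real function.\<close>
  let ?\<phi> = "\<lambda>\<tau>::real. f (y + \<tau> *\<^sub>R (z - y))"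
  have "convex_on UNIV ?\<phi>"
  proof (rule convex_onI)
    fix \<tau> a b :: real assume \<tau>: "0 < \<tau>" "\<tau> < 1"
    have "y + ((1 - \<tau>) *\<^sub>R a + \<tau> *\<^sub>R b) *\<^sub>R (z - y)
      = (1 - \<tau>) *\<^sub>R (y + a *\<^sub>R (z - y)) + \<tau> *\<^sub>R (y + b *\<^sub>R (z - y))"
      by (simp add: algebra_simps)
    then show "?\<phi> ((1 - \<tau>) *\<^sub>R a + \<tau> *\<^sub>R b) \<le> (1 - \<tau>) * ?\<phi> a + \<tau> * ?\<phi> b"
      using convex_onD[OF assms(2), of \<tau> "y + a *\<^sub>R (z - y)" "y + b *\<^sub>R (z - y)"] \<tau> by simp
  qed simp
  moreover have "(?\<phi> has_real_derivative d \<bullet> (z - y)) (at 0 within UNIV)"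
  proof -
    have "(f has_derivative (\<lambda>h. h \<bullet> d)) (at (y + 0 *\<^sub>R (z - y)))"
      using assms(1) by (simp add: gderiv_def)
    moreover have "((\<lambda>\<tau>::real. y + \<tau> *\<^sub>R (z - y)) has_derivative (\<lambda>\<tau>. \<tau> *\<^sub>R (z - y))) (at 0)"
      by (auto intro!: derivative_eq_intros)
    ultimately have "(?\<phi> has_derivative (\<lambda>\<tau>. (\<tau> *\<^sub>R (z - y)) \<bullet> d)) (at 0)"
      by (rule has_derivative_compose[rotated])
    then show ?thesis
      unfolding has_field_derivative_def
      by (rule has_derivative_eq_rhs) (auto simp: inner_commute)
  qed
  ultimately have "(d \<bullet> (z - y)) * (1 - 0) \<le> ?\<phi> 1 - ?\<phi> 0"
    by (intro convex_on_imp_above_tangent[where A = UNIV]) auto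
  then show ?thesis by simp
qed

lemma mat_norm_nonneg: "0 \<le> mat_norm A"
  unfolding mat_norm_def by (rule onorm_pos_le) (rule matrix_vector_mul_bounded_linear)

lemma inner_matrix_vector_le_mat_norm: "v \<bullet> (A *v v) \<le> mat_norm A * (norm v)\<^sup>2"
proof -
  have "v \<bullet> (A *v v) \<le> norm v * norm (A *v v)" by (rule norm_cauchy_schwarz)
  also have "\<dots> \<le> norm v * (mat_norm A * norm v)"
    unfolding mat_norm_def
    by (intro mult_left_mono onorm matrix_vector_mul_bounded_linear) auto
  finally show ?thesis by (simp add: power2_eq_square mult_ac)
qed

section \<open>The function \<open>\<psi>\<close>\<close>

lemma psi_ge:
  assumes "1 \<le> L" "0 \<le> y"
  shows "1 + y \<le> psi L \<beta> y"
proof -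
  have "1 * (1 + y) \<le> L * (1 + y)" using assms by (intro mult_right_mono) auto
  then show ?thesis using assms by (auto simp: psi_def)
qed

lemma psi_pos: "1 \<le> L \<Longrightarrow> 0 \<le> y \<Longrightarrow> 0 < psi L \<beta> y"
  using psi_ge[of L y \<beta>] by linarith

lemma psi_mono: "1 \<le> L \<Longrightarrow> y \<le> z \<Longrightarrow> psi L \<beta> y \<le> psi L \<beta> z"
  by (simp add: psi_def)

lemma psi_scale:
  assumes "1 \<le> L" "1 \<le> c"
  shows "psi L \<beta> (c * y) \<le> c * psi L \<beta> y"
proof -
  have "L * 1 \<le> L * c" using assms by (intro mult_left_mono) auto
  then show ?thesis by (auto simp: psi_def algebra_simps)
qed

text \<open>This is where the two branches of \<open>\<psi>\<close> come from. If \<open>\<beta> L \<le> 1\<close>, the map \<open>y \<mapsto> (1 + y)\<^bsup>\<beta>\<^esup> / (L + y)\<close> is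
  already nonincreasing. Otherwise it can increase for small \<open>y\<close>, and one passes from \<open>L + y\<close> to the larger
  \<open>L (1 + y)\<close>, for which the quotient is nonincreasing whenever \<open>\<beta> \<le> 1\<close>.\<close>

lemma powr_over_psi_le:
  assumes L: "1 \<le> L" and \<beta>: "0 \<le> \<beta>" "\<beta> \<le> 1" and y: "0 \<le> y" "y \<le> M"
  shows "(1 + M) powr \<beta> / psi L \<beta> M \<le> (1 + y) powr \<beta> / (L + y)"
proof -
  define q where "q = (1 + M) / (1 + y)"
  have q: "1 \<le> q" "(1 + M) powr \<beta> = (1 + y) powr \<beta> * q powr \<beta>"
    using y by (auto simp: q_def simp flip: powr_mult)
  have "q powr \<beta> * (L + y) \<le> psi L \<beta> M"
  proof (cases "\<beta> \<le> 1 / L")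
    case True
    have *: "\<beta> * (L + y) \<le> 1 + y"
      using True L mult_right_mono[OF \<beta>(2) y(1)] by (simp add: field_simps)
    have "q powr \<beta> * (L + y) \<le> (1 + \<beta> * (q - 1)) * (L + y)"
      using q \<beta> L y by (intro mult_right_mono powr_Bernoulli_le) auto
    also have "\<dots> = L + y + (q - 1) * (\<beta> * (L + y))" by (simp add: algebra_simps)
    also have "\<dots> \<le> L + y + (q - 1) * (1 + y)"
      using * q by (intro add_left_mono mult_left_mono) auto
    also have "\<dots> = L + M" using y by (simp add: q_def field_simps)
    finally show ?thesis using True by (simp add: psi_def)
  next
    case False
    have "1 * y \<le> L * y" using L y by (intro mult_right_mono) auto
    then have "L + y \<le> L * (1 + y)" by (simp add: algebra_simps)
    moreover have "q powr \<beta> \<le> q powr 1" using \<beta> q by (intro powr_mono) auto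
    ultimately have "q powr \<beta> * (L + y) \<le> q * (L * (1 + y))"
      using q L y by (intro mult_mono) auto
    also have "\<dots> = L * (1 + M)" using y by (simp add: q_def)
    finally show ?thesis using False by (simp add: psi_def)
  qed
  then have "q powr \<beta> / psi L \<beta> M \<le> 1 / (L + y)"
    using L y psi_pos[of L M \<beta>] by (simp add: divide_le_eq le_divide_eq)
  then have "(1 + y) powr \<beta> * (q powr \<beta> / psi L \<beta> M) \<le> (1 + y) powr \<beta> * (1 / (L + y))"
    by (intro mult_left_mono) auto
  then show ?thesis using q by simp
qed

section \<open>One iteration of the algorithm\<close>

context trust_region_run
begin

abbreviation gnorm :: "nat \<Rightarrow> real" where "gnorm k \<equiv> norm (g (x k))"
abbreviation bnorm :: "nat \<Rightarrow> real" where "bnorm k \<equiv> mat_norm (B k)"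
abbreviation radius :: "nat \<Rightarrow> real" where "radius k \<equiv> tr_radius g \<alpha> \<beta> (x k) (B k) (\<Delta> k)"
abbreviation ratio :: "nat \<Rightarrow> real" where "ratio k \<equiv> tr_ratio f g (x k) (B k) (s k)"
abbreviation decrease :: "nat \<Rightarrow> real" where
  "decrease k \<equiv> model f g (x k) (B k) 0 - model f g (x k) (B k) (s k)"
abbreviation amin :: real where "amin \<equiv> a_min \<gamma>1 \<kappa>mdc \<eta>2 \<alpha> (\<Delta> 0) (g (x 0))"

lemma radius_nonneg: "0 \<le> radius k"
  using step_bound[of k] norm_ge_zero order_trans by blast

lemma Delta_Suc_ge: "0 < \<Delta> k \<Longrightarrow> \<gamma>1 * \<Delta> k \<le> \<Delta> (Suc k)"
proof -
  assume D: "0 < \<Delta> k"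
  have "\<gamma>1 * \<Delta> k \<le> \<gamma>2 * \<Delta> k" "\<gamma>1 * \<Delta> k \<le> \<gamma>3 * \<Delta> k"
    using D gamma by (auto intro: mult_right_mono)
  then show ?thesis
    using radius_very_successful[of k] radius_successful[of k] radius_unsuccessful[of k]
    by (cases "\<eta>2 \<le> ratio k"; cases "\<eta>1 \<le> ratio k") auto
qed

lemma Delta_pos: "0 < \<Delta> k"
proof (induction k)
  case 0
  show ?case by (rule Delta_0)
next
  case (Suc k)
  then have "0 < \<gamma>1 * \<Delta> k" using gamma by simp
  then show ?case using Delta_Suc_ge[OF Suc] by linarith
qed

lemma Delta_Suc_ge_very_successful:
  assumes "\<eta>2 \<le> ratio k"
  shows "\<Delta> k \<le> \<Delta> (Suc k)"
proof -
  have "1 * \<Delta> k \<le> \<gamma>3 * \<Delta> k" using gamma Delta_pos[of k] by (intro mult_right_mono) auto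
  then show ?thesis using radius_very_successful[OF assms] by simp
qed

text \<open>The Cauchy step is compared with the step of length \<open>\<tau> = min (r / \<parallel>g\<parallel>) (1 / (1 + \<parallel>B\<parallel>))\<close> along the negative
  gradient \<open>-g\<close>: it is feasible, and at most half of its linear gain \<open>\<tau> \<parallel>g\<parallel>\<^sup>2\<close> is lost to the curvature.\<close>

lemma cauchy_decrease:
  "1/2 * gnorm k * min (radius k) (gnorm k / (1 + bnorm k))
    \<le> model f g (x k) (B k) 0 - model f g (x k) (B k) (- t k *\<^sub>R g (x k))"
proof (cases "gnorm k = 0")
  case True
  then show ?thesis by (simp add: model_def)
next
  case False
  then have G: "0 < gnorm k" by simp
  have b: "0 < 1 + bnorm k" using mat_norm_nonneg[of "B k"] by linarith
  define \<tau> where "\<tau> = min (radius k / gnorm k) (1 / (1 + bnorm k))"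
  have \<tau>: "0 \<le> \<tau>" using G b radius_nonneg[of k] by (simp add: \<tau>_def)
  have "\<tau> \<le> 1 / (1 + bnorm k)" by (simp add: \<tau>_def)
  then have \<tau>b: "\<tau> * bnorm k \<le> 1"
    using b \<tau> by (simp add: field_simps)
  have "\<tau> \<le> radius k / gnorm k" by (simp add: \<tau>_def)
  then have feasible: "norm (\<tau> *\<^sub>R g (x k)) \<le> radius k" using G \<tau> by (simp add: field_simps)
  have "model f g (x k) (B k) (- t k *\<^sub>R g (x k)) \<le> model f g (x k) (B k) (- \<tau> *\<^sub>R g (x k))"
    using cauchy_point[of k] feasible \<tau> unfolding is_arg_min_linorder by blast
  also have "\<dots> = f (x k) - \<tau> * (gnorm k)\<^sup>2 + 1/2 * \<tau>\<^sup>2 * (g (x k) \<bullet> (B k *v g (x k)))"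
    by (simp add: model_def power2_norm_eq_inner matrix_vector_mult_scaleR
        flip: scaleR_minus_left) (simp add: power2_eq_square)
  also have "\<dots> \<le> f (x k) - \<tau> * (gnorm k)\<^sup>2 + 1/2 * \<tau>\<^sup>2 * (bnorm k * (gnorm k)\<^sup>2)"
    by (intro add_left_mono mult_left_mono inner_matrix_vector_le_mat_norm) auto
  also have "\<dots> = f (x k) - \<tau> * (gnorm k)\<^sup>2 + 1/2 * \<tau> * (gnorm k)\<^sup>2 * (\<tau> * bnorm k)"
    by (simp add: power2_eq_square)
  also have "\<dots> \<le> f (x k) - \<tau> * (gnorm k)\<^sup>2 + 1/2 * \<tau> * (gnorm k)\<^sup>2 * 1"
    using \<tau> \<tau>b by (intro add_left_mono mult_left_mono) auto
  finally have "1/2 * \<tau> * (gnorm k)\<^sup>2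
      \<le> model f g (x k) (B k) 0 - model f g (x k) (B k) (- t k *\<^sub>R g (x k))"
    by (simp add: model_def)
  moreover have "\<tau> * gnorm k = min (radius k) (gnorm k / (1 + bnorm k))"
    using G by (simp add: \<tau>_def min_mult_distrib_right)
  ultimately show ?thesis by (simp add: power2_eq_square mult_ac)
qed

lemma model_decrease: "\<kappa>mdc * gnorm k * min (radius k) (gnorm k / (1 + bnorm k)) \<le> decrease k"
proof -
  have "2 * \<kappa>mdc * (1/2 * gnorm k * min (radius k) (gnorm k / (1 + bnorm k))) \<le> decrease k"
    using kappa_mdc by (intro order_trans[OF mult_left_mono[OF cauchy_decrease] step_decrease]) auto
  then show ?thesis by simp
qed

lemma decrease_nonneg: "0 \<le> decrease k"
proof -
  have "0 \<le> \<kappa>mdc * gnorm k * min (radius k) (gnorm k / (1 + bnorm k))"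
    using kappa_mdc radius_nonneg[of k] mat_norm_nonneg[of "B k"] by simp
  then show ?thesis using model_decrease[of k] by linarith
qed

text \<open>Since \<open>\<eta>1 > 0\<close>, a successful ratio excludes a vanishing denominator, for which the
  quotient would be \<open>0\<close>.\<close>

lemma actual_decrease:
  assumes "\<eta>1 \<le> ratio k"
  shows "0 < f (x k) - f (x (Suc k))" "\<eta>1 * decrease k \<le> f (x k) - f (x (Suc k))"
proof -
  have "0 < ratio k" using assms eta by linarith
  then have "0 < decrease k" "0 < f (x k) - f (x k + s k)"
    using decrease_nonneg[of k] by (auto simp: tr_ratio_def zero_less_divide_iff)
  moreover have "x (Suc k) = x k + s k" using assms iterate_update by simp
  ultimately show "0 < f (x k) - f (x (Suc k))" "\<eta>1 * decrease k \<le> f (x k) - f (x (Suc k))"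
    using assms by (auto simp: tr_ratio_def field_simps)
qed

lemma f_Suc_le: "f (x (Suc k)) \<le> f (x k)"
  using actual_decrease(1)[of k] iterate_update[of k] by (cases "\<eta>1 \<le> ratio k") auto

lemma f_antimono: "j \<le> k \<Longrightarrow> f (x k) \<le> f (x j)"
  using f_Suc_le by (rule lift_Suc_antimono_le)

text \<open>The smallness condition makes the radius the smaller argument of the minimum in the model
  decrease, which is thus at least \<open>\<kappa>mdc \<parallel>g\<parallel> r\<close>; it also bounds the model error, of order \<open>(L + \<parallel>B\<parallel>) r\<^sup>2\<close>,
  by the fraction \<open>1 - \<eta>2\<close> of that decrease.\<close>

lemma very_successful_if_radius_small:
  assumes L: "1 \<le> L"
    and err: "\<bar>f (x k + s k) - model f g (x k) (B k) (s k)\<bar> \<le> 1/2 * (L + bnorm k) * (norm (s k))\<^sup>2"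
    and G: "0 < gnorm k" and r: "0 < radius k"
    and small: "radius k * (L + bnorm k) \<le> 2 * \<kappa>mdc * (1 - \<eta>2) * gnorm k"
  shows "\<eta>2 \<le> ratio k"
proof -
  have b: "0 \<le> bnorm k" by (rule mat_norm_nonneg)
  have "radius k * (1 + bnorm k) \<le> radius k * (L + bnorm k)"
    using L r by (intro mult_left_mono) auto
  also have "\<dots> \<le> 2 * \<kappa>mdc * (1 - \<eta>2) * gnorm k" by (rule small)
  also have "\<dots> \<le> 1 * 1 * gnorm k"
    using kappa_mdc eta by (intro mult_mono) auto
  finally have "radius k \<le> gnorm k / (1 + bnorm k)" using b by (simp add: field_simps)
  then have dec: "\<kappa>mdc * gnorm k * radius k \<le> decrease k" using model_decrease[of k] by simp
  moreover have "0 < \<kappa>mdc * gnorm k * radius k" using kappa_mdc G r by simp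
  ultimately have D: "0 < decrease k" by linarith
  have "1/2 * (L + bnorm k) * (norm (s k))\<^sup>2 \<le> 1/2 * (L + bnorm k) * (radius k)\<^sup>2"
    using L b step_bound[of k] by (intro mult_left_mono power_mono) auto
  also have "\<dots> = 1/2 * radius k * (radius k * (L + bnorm k))" by (simp add: power2_eq_square)
  also have "\<dots> \<le> 1/2 * radius k * (2 * \<kappa>mdc * (1 - \<eta>2) * gnorm k)"
    using r small by (intro mult_left_mono) auto
  also have "\<dots> = (1 - \<eta>2) * (\<kappa>mdc * gnorm k * radius k)" by simp
  also have "\<dots> \<le> (1 - \<eta>2) * decrease k" using dec eta by (intro mult_left_mono) auto
  finally have "f (x k + s k) - model f g (x k) (B k) (s k) \<le> (1 - \<eta>2) * decrease k"
    using err by linarith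
  moreover have "f (x k) - f (x k + s k)
      = decrease k - (f (x k + s k) - model f g (x k) (B k) (s k))"
    by (simp add: model_def)
  ultimately have "\<eta>2 * decrease k \<le> f (x k) - f (x k + s k)"
    by (simp add: left_diff_distrib)
  then show ?thesis using D by (simp add: tr_ratio_def field_simps)
qed

lemma radius_eq: "0 < gnorm k \<Longrightarrow> radius k = gnorm k powr \<alpha> / (1 + bnorm k) powr \<beta> * \<Delta> k"
  using mat_norm_nonneg[of "B k"] by (simp add: tr_radius_def rpow_eq_powr)

lemma amin_pos: "0 < gnorm 0 \<Longrightarrow> 0 < amin"
  using gamma eta kappa_mdc Delta_0 by (simp add: a_min_def rpow_eq_powr)

lemma amin_le:
  assumes "0 < gnorm 0"
  shows "amin \<le> 2 * \<gamma>1 * \<kappa>mdc * (1 - \<eta>2)" "amin \<le> 1" "amin * gnorm 0 powr (1 - \<alpha>) \<le> \<Delta> 0"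
proof -
  define c where "c = 2 * \<gamma>1 * \<kappa>mdc * (1 - \<eta>2)"
  have c: "0 < c" using gamma eta kappa_mdc by (simp add: c_def)
  have "\<gamma>1 * (2 * \<kappa>mdc) * (1 - \<eta>2) \<le> 1 * 1 * 1"
    using gamma eta kappa_mdc by (intro mult_mono) auto
  then have c1: "c \<le> 1" by (simp add: c_def mult_ac)
  have a: "amin = c * min 1 (\<Delta> 0 / gnorm 0 powr (1 - \<alpha>))"
    using assms by (simp add: a_min_def c_def rpow_eq_powr)
  have "amin \<le> c * 1" unfolding a using c by (intro mult_left_mono) auto
  then show "amin \<le> 2 * \<gamma>1 * \<kappa>mdc * (1 - \<eta>2)" "amin \<le> 1" using c1 by (auto simp: c_def)
  have "amin \<le> 1 * (\<Delta> 0 / gnorm 0 powr (1 - \<alpha>))"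
    unfolding a using c c1 Delta_0 assms by (intro mult_mono) auto
  then show "amin * gnorm 0 powr (1 - \<alpha>) \<le> \<Delta> 0" using assms by (simp add: field_simps)
qed

text \<open>By induction over the iterations up to \<open>k\<close>, with \<open>G\<close> and \<open>M\<close> fixed. A very successful iteration
  does not shrink \<open>\<Delta>\<close>. In any other iteration the radius is too large for
  \<open>very_successful_if_radius_small\<close>, and the loss of at most the factor \<open>\<gamma>1\<close> is accounted for in \<open>a_min\<close>; the
  current \<open>\<parallel>B\<^sub>i\<parallel>\<close> is replaced by \<open>M\<close> with \<open>powr_over_psi_le\<close>. The minimum in \<open>a_min\<close> serves the initial radius.\<close>

lemma Delta_lower_bound:
  assumes L: "1 \<le> L"
    and err: "\<And>i. \<bar>f (x i + s i) - model f g (x i) (B i) (s i)\<bar> \<le> 1/2 * (L + bnorm i) * (norm (s i))\<^sup>2"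
    and G: "0 < G" "\<And>i. i \<le> k \<Longrightarrow> G \<le> gnorm i"
    and M: "\<And>i. i \<le> k \<Longrightarrow> bnorm i \<le> M"
  shows "amin * G powr (1 - \<alpha>) * ((1 + M) powr \<beta> / psi L \<beta> M) \<le> \<Delta> k"
proof -
  have G0: "0 < gnorm 0" using G(1) G(2)[of 0] by linarith
  have M0: "0 \<le> M" using M[of 0] mat_norm_nonneg[of "B 0"] by simp
  have a0: "0 < amin" by (rule amin_pos[OF G0])
  have psi0: "0 < psi L \<beta> M" by (rule psi_pos[OF L M0])
  let ?low = "amin * G powr (1 - \<alpha>) * ((1 + M) powr \<beta> / psi L \<beta> M)"
  have "i \<le> k \<Longrightarrow> ?low \<le> \<Delta> i" for i
  proof (induction i)
    case 0
    have "(1 + M) powr \<beta> \<le> (1 + M) powr 1" using beta M0 by (intro powr_mono) auto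
    then have "(1 + M) powr \<beta> / psi L \<beta> M \<le> 1"
      using psi_ge[OF L M0, of \<beta>] M0 psi0 by simp
    moreover have "G powr (1 - \<alpha>) \<le> gnorm 0 powr (1 - \<alpha>)"
      using G alpha by (intro powr_mono2) auto
    ultimately have "?low \<le> amin * gnorm 0 powr (1 - \<alpha>) * 1"
      using a0 psi0 by (intro mult_mono mult_left_mono) auto
    then show ?case using amin_le(3)[OF G0] by simp
  next
    case (Suc i)
    then have IH: "?low \<le> \<Delta> i" and i: "i \<le> k" by auto
    have Gi: "0 < gnorm i" using G(1) G(2)[OF i] by linarith
    have bi: "0 \<le> bnorm i" by (rule mat_norm_nonneg)
    show ?case
    proof (cases "\<eta>2 \<le> ratio i")
      case True
      then show ?thesis using IH Delta_Suc_ge_very_successful by (meson order_trans)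
    next
      case False
      have ri: "0 < radius i" using Gi bi Delta_pos[of i] by (simp add: radius_eq)
      have "2 * \<kappa>mdc * (1 - \<eta>2) * gnorm i \<le> radius i * (L + bnorm i)"
        using very_successful_if_radius_small[OF L err Gi ri] False by linarith
      also have "\<dots> = gnorm i powr \<alpha> * (\<Delta> i * (L + bnorm i) / (1 + bnorm i) powr \<beta>)"
        using Gi by (simp add: radius_eq)
      finally have "2 * \<kappa>mdc * (1 - \<eta>2) * (gnorm i / gnorm i powr \<alpha>)
          \<le> \<Delta> i * (L + bnorm i) / (1 + bnorm i) powr \<beta>"
        using Gi by (simp add: field_simps)
      moreover have "gnorm i / gnorm i powr \<alpha> = gnorm i powr (1 - \<alpha>)"
        using Gi by (simp add: powr_diff)
      ultimately have "2 * \<kappa>mdc * (1 - \<eta>2) * gnorm i powr (1 - \<alpha>)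
          \<le> \<Delta> i * (L + bnorm i) / (1 + bnorm i) powr \<beta>" by simp
      then have low: "2 * \<kappa>mdc * (1 - \<eta>2) * gnorm i powr (1 - \<alpha>)
          * ((1 + bnorm i) powr \<beta> / (L + bnorm i)) \<le> \<Delta> i"
        using bi L by (simp add: field_simps)
      have "?low \<le> (2 * \<gamma>1 * \<kappa>mdc * (1 - \<eta>2)) * gnorm i powr (1 - \<alpha>)
          * ((1 + bnorm i) powr \<beta> / (L + bnorm i))"
        using amin_le(1)[OF G0] a0 G i alpha psi0 bi L M[OF i] beta eta gamma kappa_mdc
        by (intro mult_mono powr_mono2 powr_over_psi_le) auto
      also have "\<dots> \<le> \<gamma>1 * \<Delta> i"
        using mult_left_mono[OF low, of \<gamma>1] gamma by (simp add: mult_ac)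
      also have "\<dots> \<le> \<Delta> (Suc i)" by (rule Delta_Suc_ge[OF Delta_pos])
      finally show ?thesis .
    qed
  qed
  then show ?thesis by simp
qed

text \<open>In the product \<open>\<parallel>g\<parallel> r\<close> the gradient norm enters with the exponent \<open>1 + \<alpha> \<ge> 0\<close> and the bound on \<open>\<Delta>\<close>
  contributes \<open>G\<^bsup>1 - \<alpha>\<^esup>\<close>, which makes \<open>G\<^sup>2\<close> for every \<open>\<alpha>\<close>. The factor \<open>(1 + M)\<^bsup>\<beta>\<^esup>\<close> makes up for the
  scaling of the radius by \<open>(1 + \<parallel>B\<parallel>)\<^bsup>-\<beta>\<^esup>\<close>.\<close>

lemma successful_decrease:
  assumes L: "1 \<le> L"
    and err: "\<And>i. \<bar>f (x i + s i) - model f g (x i) (B i) (s i)\<bar> \<le> 1/2 * (L + bnorm i) * (norm (s i))\<^sup>2"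
    and G: "0 < G" "\<And>i. i \<le> k \<Longrightarrow> G \<le> gnorm i"
    and M: "\<And>i. i \<le> k \<Longrightarrow> bnorm i \<le> M"
    and succ: "\<eta>1 \<le> ratio k"
  shows "\<eta>1 * \<kappa>mdc * amin * G\<^sup>2 / psi L \<beta> M \<le> f (x k) - f (x (Suc k))"
proof -
  have G0: "0 < gnorm 0" using G(1) G(2)[of 0] by linarith
  have M0: "0 \<le> M" using M[of 0] mat_norm_nonneg[of "B 0"] by simp
  have a0: "0 < amin" by (rule amin_pos[OF G0])
  have psi0: "0 < psi L \<beta> M" by (rule psi_pos[OF L M0])
  have Gk: "0 < gnorm k" "G \<le> gnorm k" using G(1) G(2)[of k] by linarith+
  have bk: "0 \<le> bnorm k" "bnorm k \<le> M" using M[of k] by (auto simp: mat_norm_nonneg)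
  have "amin * G\<^sup>2 / psi L \<beta> M \<le> gnorm k * radius k"
  proof -
    have "amin * G\<^sup>2 / psi L \<beta> M
        = amin * (G powr (1 + \<alpha>) * G powr (1 - \<alpha>)) * (1 / psi L \<beta> M)"
      using G(1) by (simp flip: powr_add)
    also have "\<dots> \<le> amin * (gnorm k powr (1 + \<alpha>) * G powr (1 - \<alpha>))
        * (((1 + M) powr \<beta> / (1 + bnorm k) powr \<beta>) / psi L \<beta> M)"
    proof (intro mult_mono divide_right_mono powr_mono2)
      have "(1 + bnorm k) powr \<beta> \<le> (1 + M) powr \<beta>" using bk beta by (intro powr_mono2) auto
      then show "1 \<le> (1 + M) powr \<beta> / (1 + bnorm k) powr \<beta>" using bk by simp
    qed (use a0 G Gk alpha psi0 in auto)
    also have "\<dots> = gnorm k powr (1 + \<alpha>) / (1 + bnorm k) powr \<beta>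
        * (amin * G powr (1 - \<alpha>) * ((1 + M) powr \<beta> / psi L \<beta> M))" by simp
    also have "\<dots> \<le> gnorm k powr (1 + \<alpha>) / (1 + bnorm k) powr \<beta> * \<Delta> k"
      using Delta_lower_bound[OF L err G M] by (intro mult_left_mono) auto
    also have "\<dots> = gnorm k * radius k" using Gk by (simp add: radius_eq powr_add)
    finally show ?thesis .
  qed
  moreover have "amin * G\<^sup>2 / psi L \<beta> M \<le> gnorm k * (gnorm k / (1 + bnorm k))"
  proof -
    have "amin * G\<^sup>2 / psi L \<beta> M \<le> 1 * (gnorm k)\<^sup>2 / (1 + bnorm k)"
      using amin_le(2)[OF G0] a0 Gk G(1) bk psi_ge[OF L M0, of \<beta>]
      by (intro frac_le mult_mono power_mono) auto
    then show ?thesis by (simp add: power2_eq_square)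
  qed
  ultimately have "amin * G\<^sup>2 / psi L \<beta> M \<le> gnorm k * min (radius k) (gnorm k / (1 + bnorm k))"
    by (simp add: min_def)
  then have "\<kappa>mdc * (amin * G\<^sup>2 / psi L \<beta> M)
      \<le> \<kappa>mdc * (gnorm k * min (radius k) (gnorm k / (1 + bnorm k)))"
    using kappa_mdc by (intro mult_left_mono) auto
  also have "\<dots> \<le> decrease k" using model_decrease[of k] by (simp add: mult_ac)
  finally have "\<eta>1 * (\<kappa>mdc * (amin * G\<^sup>2 / psi L \<beta> M)) \<le> \<eta>1 * decrease k"
    using eta by (intro mult_left_mono) auto
  also have "\<dots> \<le> f (x k) - f (x (Suc k))" by (rule actual_decrease(2)[OF succ])
  finally show ?thesis by (simp add: mult_ac)
qed

text \<open>A success strictly decreases \<open>f\<close>, so there is none after a minimal value has been reached. For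
  convex \<open>f\<close> this excludes stationary iterates without a discussion of the radius at a zero gradient.\<close>

lemma not_minimal_if_infinite_successes:
  assumes min: "\<And>y. fl \<le> f y" and inf: "infinite (successful f g \<eta>1 x B s)"
  shows "fl < f (x k)"
proof (rule ccontr)
  assume "\<not> fl < f (x k)"
  then have "f (x k) = fl" using min[of "x k"] by simp
  have "\<not> \<eta>1 \<le> ratio j" if "k \<le> j" for j
    using actual_decrease(1)[of j] f_antimono[OF that] min[of "x (Suc j)"] \<open>f (x k) = fl\<close> by auto
  then have "successful f g \<eta>1 x B s \<subseteq> {..<k}" by (force simp: successful_def not_le)
  then show False using inf finite_subset by blast
qed

end

section \<open>Convex objectives\<close>

locale convex_trust_region_run = trust_region_run f g \<eta>1 \<eta>2 \<gamma>1 \<gamma>2 \<gamma>3 \<gamma>4 \<kappa>mdc \<alpha> \<beta> x B t s \<Delta>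
  for f :: "real^'n \<Rightarrow> real" and g :: "real^'n \<Rightarrow> real^'n"
    and \<eta>1 \<eta>2 \<gamma>1 \<gamma>2 \<gamma>3 \<gamma>4 \<kappa>mdc \<alpha> \<beta> :: real
    and x :: "nat \<Rightarrow> real^'n" and B :: "nat \<Rightarrow> real^'n^'n" and t :: "nat \<Rightarrow> real"
    and s :: "nat \<Rightarrow> real^'n" and \<Delta> :: "nat \<Rightarrow> real" +
  fixes xstar :: "real^'n" and R L :: real
  assumes gradient: "\<And>y. GDERIV f y :> g y"
    and convex: "convex_on UNIV f"
    and minimizer: "\<And>y. f xstar \<le> f y"
    and R_pos: "0 < R"
    and level_set: "\<And>y. f y \<le> f (x 0) \<Longrightarrow> norm (y - xstar) \<le> R"
    and L_ge_1: "1 \<le> L"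
    and model_error: "\<And>k. \<bar>f (x k + s k) - model f g (x k) (B k) (s k)\<bar>
          \<le> 1/2 * (L + mat_norm (B k)) * (norm (s k))\<^sup>2"
    and infinite_successes: "infinite (successful f g \<eta>1 x B s)"
begin

abbreviation gap :: "nat \<Rightarrow> real" where "gap k \<equiv> f (x k) - f xstar"
abbreviation successes :: "nat \<Rightarrow> nat" where
  "successes k \<equiv> card {i \<in> successful f g \<eta>1 x B s. i < k}"

lemma gap_pos: "0 < gap k"
  using not_minimal_if_infinite_successes[of "f xstar", OF minimizer infinite_successes] by simp

text \<open>The gap at \<open>k\<close> bounds all earlier gradient norms from below, which is what the lower bound on
  the radius parameter asks for.\<close>

lemma gap_le_gnorm:
  assumes "j \<le> k"
  shows "gap k / R \<le> gnorm j"
proof -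
  have "gap k \<le> gap j" using f_antimono[OF assms] by simp
  also have "\<dots> \<le> g (x j) \<bullet> (x j - xstar)"
    using convex_above_tangent_plane[OF gradient convex, of "x j" xstar] by (simp add: inner_diff_right)
  also have "\<dots> \<le> gnorm j * norm (x j - xstar)" by (rule norm_cauchy_schwarz)
  also have "\<dots> \<le> gnorm j * R"
    using level_set[OF f_antimono[of 0 j]] by (intro mult_left_mono) auto
  finally show ?thesis using R_pos by (simp add: field_simps)
qed

lemma gnorm_pos: "0 < gnorm k"
proof -
  have "0 < gap k / R" using gap_pos R_pos by simp
  also have "\<dots> \<le> gnorm k" by (rule gap_le_gnorm) simp
  finally show ?thesis .
qed

text \<open>Only successful iterations change the gap, and the one with \<open>j\<close> predecessors contributes the
  \<open>j\<close>-th summand.\<close>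

lemma inverse_gap_ge_sum:
  assumes "\<And>k. Max ((\<lambda>j. bnorm j) ` {0..k}) \<le> h (successes k)"
  shows "(\<Sum>j<successes k. \<eta>1 * \<kappa>mdc * amin / (R\<^sup>2 * psi L \<beta> (h j))) \<le> inverse (gap k)"
proof (induction k)
  case 0
  show ?case using gap_pos[of 0] by (simp add: less_imp_le)
next
  case (Suc k)
  show ?case
  proof (cases "k \<in> successful f g \<eta>1 x B s")
    case False
    then have "{i \<in> successful f g \<eta>1 x B s. i < Suc k} = {i \<in> successful f g \<eta>1 x B s. i < k}"
      by (auto simp: less_Suc_eq)
    moreover have "x (Suc k) = x k" using False iterate_update by (simp add: successful_def)
    ultimately show ?thesis using Suc by simp
  next
    case True
    then have "{i \<in> successful f g \<eta>1 x B s. i < Suc k}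
        = insert k {i \<in> successful f g \<eta>1 x B s. i < k}"
      by (auto simp: less_Suc_eq)
    then have count: "successes (Suc k) = Suc (successes k)" by simp
    have ratio: "\<eta>1 \<le> ratio k" using True by (simp add: successful_def)
    have bound: "bnorm i \<le> h (successes k)" if "i \<le> k" for i
    proof -
      have "bnorm i \<le> Max ((\<lambda>j. bnorm j) ` {0..k})" using that by (intro Max_ge) auto
      then show ?thesis using assms[of k] by linarith
    qed
    have "\<eta>1 * \<kappa>mdc * amin * (gap k / R)\<^sup>2 / psi L \<beta> (h (successes k)) \<le> f (x k) - f (x (Suc k))"
      using gap_pos[of k] R_pos gap_le_gnorm bound ratio
      by (intro successful_decrease[OF L_ge_1 model_error]) auto
    then have "\<eta>1 * \<kappa>mdc * amin / (R\<^sup>2 * psi L \<beta> (h (successes k))) * (gap k)\<^sup>2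
        \<le> gap k - gap (Suc k)"
      by (simp add: power_divide)
    then have "inverse (gap k) + \<eta>1 * \<kappa>mdc * amin / (R\<^sup>2 * psi L \<beta> (h (successes k)))
        \<le> inverse (gap (Suc k))"
      using gap_pos[of "Suc k"] f_Suc_le[of k] by (intro inverse_gap_increase) auto
    then show ?thesis using Suc count by simp
  qed
qed

text \<open>The previous bound multiplied by \<open>R\<^sup>2 \<psi>(2\<mu>) / (\<eta>1 \<kappa>mdc a_min)\<close>. The gap at \<open>k\<close> exceeds \<open>\<epsilon>\<close>, in
  particular \<open>k\<close> may be the crossing iteration itself.\<close>

lemma sum_weights_le:
  assumes mu_pos: "0 < \<mu>"
    and growth: "\<And>k. Max ((\<lambda>j. bnorm j) ` {0..k}) \<le> \<mu> * (1 + rpow (real (successes k)) p)"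
    and \<epsilon>: "0 < \<epsilon>" "\<epsilon> < gap k"
  shows "(\<Sum>j<successes k. psi L \<beta> (2 * \<mu>) / psi L \<beta> (\<mu> * (1 + rpow (real j) p)))
    \<le> R\<^sup>2 * (psi L \<beta> (2 * \<mu>) / (\<eta>1 * \<kappa>mdc * amin)) * inverse \<epsilon>"
proof -
  let ?w = "\<lambda>j. psi L \<beta> (\<mu> * (1 + rpow (real j) p))"
  define c where "c = \<eta>1 * \<kappa>mdc * amin"
  define q where "q = psi L \<beta> (2 * \<mu>)"
  have c: "0 < c" using eta kappa_mdc amin_pos[OF gnorm_pos] by (simp add: c_def)
  have q: "0 < q" using psi_pos[OF L_ge_1] mu_pos by (simp add: q_def)
  have "(\<Sum>j<successes k. c / (R\<^sup>2 * ?w j)) \<le> inverse (gap k)"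
    unfolding c_def by (rule inverse_gap_ge_sum[of "\<lambda>n. \<mu> * (1 + rpow (real n) p)", OF growth])
  also have "\<dots> \<le> inverse \<epsilon>" using \<epsilon> by (intro le_imp_inverse_le) auto
  finally have "R\<^sup>2 * (q / c) * (\<Sum>j<successes k. c / (R\<^sup>2 * ?w j)) \<le> R\<^sup>2 * (q / c) * inverse \<epsilon>"
    using c q by (intro mult_left_mono) auto
  moreover have "R\<^sup>2 * (q / c) * (\<Sum>j<successes k. c / (R\<^sup>2 * ?w j)) = (\<Sum>j<successes k. q / ?w j)"
    using c R_pos by (simp add: sum_distrib_left)
  ultimately show ?thesis by (simp add: c_def q_def)
qed

lemma S_hat_le:
  assumes F: "\<And>\<epsilon> k. 0 < \<epsilon> \<Longrightarrow> \<epsilon> < gap k \<Longrightarrow> real (successes k) \<le> F \<epsilon>"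
    and "0 < \<epsilon>" "crosses gap \<epsilon> k"
  shows "real (card (S_hat (successful f g \<eta>1 x B s) gap \<epsilon>)) \<le> F \<epsilon>"
proof -
  have "crosses gap \<epsilon> (k_hat gap \<epsilon>)" unfolding k_hat_def using assms(3) by (rule LeastI)
  then show ?thesis unfolding S_hat_def using assms(2) by (intro F) (auto simp: crosses_def)
qed

text \<open>If \<open>\<epsilon>\<close> were never crossed, all gaps would exceed it and the bound \<open>F \<epsilon>\<close> would hold for the total
  number of successes, which is infinite.\<close>

lemma eventually_crosses:
  assumes F: "\<And>\<epsilon> k. 0 < \<epsilon> \<Longrightarrow> \<epsilon> < gap k \<Longrightarrow> real (successes k) \<le> F \<epsilon>"
    and \<epsilon>: "0 < \<epsilon>" "\<epsilon> < gap 0"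
  shows "\<exists>k. crosses gap \<epsilon> k"
proof (rule ccontr)
  assume no: "\<nexists>k. crosses gap \<epsilon> k"
  have above: "\<epsilon> < gap k" for k
  proof (induction k)
    case 0
    show ?case by (rule \<epsilon>)
  next
    case (Suc k)
    then show ?case using no unfolding crosses_def by (meson not_le)
  qed
  obtain n :: nat where n: "F \<epsilon> < real n" using reals_Archimedean2 by blast
  obtain T where T: "T \<subseteq> successful f g \<eta>1 x B s" "finite T" "card T = n"
    using infinite_arbitrarily_large[OF infinite_successes] by blast
  obtain k where "T \<subseteq> {..<k}" using finite_nat_bounded[OF T(2)] by blast
  then have "card T \<le> successes k" using T by (intro card_mono) auto
  then show False using F[OF \<epsilon>(1) above, of k] n T(3) by simp
qed

lemma S_hat_bigo:
  assumes F: "\<And>\<epsilon> k. 0 < \<epsilon> \<Longrightarrow> \<epsilon> < gap k \<Longrightarrow> real (successes k) \<le> F \<epsilon>"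
    and O: "F \<in> O[at_right 0](h)"
  shows "(\<lambda>\<epsilon>. real (card (S_hat (successful f g \<eta>1 x B s) gap \<epsilon>))) \<in> O[at_right 0](h)"
proof (rule landau_o.big_trans[OF bigoI O])
  have "eventually (\<lambda>\<epsilon>. \<epsilon> \<in> {0<..<gap 0}) (at_right 0)"
    by (rule eventually_at_right_real[OF gap_pos])
  then show "eventually (\<lambda>\<epsilon>. norm (real (card (S_hat (successful f g \<eta>1 x B s) gap \<epsilon>)))
      \<le> 1 * norm (F \<epsilon>)) (at_right 0)"
  proof eventually_elim
    case (elim \<epsilon>)
    then have \<epsilon>: "0 < \<epsilon>" "\<epsilon> < gap 0" by auto
    obtain k where k: "crosses gap \<epsilon> k" using eventually_crosses[where F = F, OF F \<epsilon>] by blast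
    have "real (card (S_hat (successful f g \<eta>1 x B s) gap \<epsilon>)) \<le> F \<epsilon>"
      by (rule S_hat_le[OF F \<epsilon>(1) k])
    then show ?case by simp
  qed
qed

end

section \<open>Counting\<close>

text \<open>For \<open>j \<ge> 1\<close> one has \<open>1 + j\<^bsup>p\<^esup> \<le> 2 j\<^bsup>p\<^esup>\<close>, and \<open>\<psi>(c y) \<le> c \<psi>(y)\<close> for \<open>c \<ge> 1\<close>. The summand for \<open>j = 0\<close>
  is kept apart because \<open>0\<^bsup>p\<^esup> = 0\<close> for \<open>p > 0\<close>; it is \<open>\<kappa>\<^sub>2\<close>.\<close>

lemma sum_weights_ge:
  assumes L: "1 \<le> L" and \<mu>: "0 < \<mu>" and p: "0 < p" and n: "1 \<le> n"
  shows "psi L \<beta> (2 * \<mu>) / psi L \<beta> \<mu> + (\<Sum>j=1..<n. real j powr (- p))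
    \<le> (\<Sum>j<n. psi L \<beta> (2 * \<mu>) / psi L \<beta> (\<mu> * (1 + rpow (real j) p)))"
proof -
  let ?w = "\<lambda>j. psi L \<beta> (2 * \<mu>) / psi L \<beta> (\<mu> * (1 + rpow (real j) p))"
  have "real j powr (- p) \<le> ?w j" if "1 \<le> j" for j
  proof -
    define c where "c = real j powr p"
    have c: "1 \<le> c" using that p by (simp add: c_def ge_one_powr_ge_zero)
    have pos: "0 < psi L \<beta> (\<mu> * (1 + c))" using c \<mu> by (intro psi_pos[OF L]) auto
    have "psi L \<beta> (\<mu> * (1 + c)) \<le> psi L \<beta> (c * (2 * \<mu>))"
      using c \<mu> by (intro psi_mono[OF L]) (simp add: distrib_left)
    also have "\<dots> \<le> c * psi L \<beta> (2 * \<mu>)" by (rule psi_scale[OF L c])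
    finally have "inverse c \<le> psi L \<beta> (2 * \<mu>) / psi L \<beta> (\<mu> * (1 + c))"
      using c pos by (simp add: inverse_eq_divide divide_le_eq le_divide_eq mult.commute)
    then show ?thesis using that p by (simp add: c_def powr_minus rpow_def)
  qed
  then have "(\<Sum>j=1..<n. real j powr (- p)) \<le> (\<Sum>j=1..<n. ?w j)" by (intro sum_mono) auto
  moreover have "(\<Sum>j<n. ?w j) = ?w 0 + (\<Sum>j=1..<n. ?w j)"
    using n by (simp add: lessThan_atLeast0 sum.atLeast_Suc_lessThan)
  moreover have "?w 0 = psi L \<beta> (2 * \<mu>) / psi L \<beta> \<mu>" using p by (simp add: rpow_def)
  ultimately show ?thesis by linarith
qed

lemma affine_powr_bigo:
  fixes K a q r :: real
  assumes "0 < K" "0 \<le> a" "0 < q" "0 < r"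
  shows "(\<lambda>\<epsilon>. (q * (K * inverse \<epsilon> - a) + 1) powr r) \<in> O[at_right 0](\<lambda>\<epsilon>. (q * inverse \<epsilon>) powr r)"
proof (rule bigoI)
  have "eventually (\<lambda>\<epsilon>. \<epsilon> \<in> {0<..<min q (K / (a + 1))}) (at_right 0)"
    using assms by (intro eventually_at_right_real) auto
  then show "eventually (\<lambda>\<epsilon>. norm ((q * (K * inverse \<epsilon> - a) + 1) powr r)
      \<le> (K + 1) powr r * norm ((q * inverse \<epsilon>) powr r)) (at_right 0)"
  proof eventually_elim
    case (elim \<epsilon>)
    then have \<epsilon>: "0 < \<epsilon>" "\<epsilon> < q" "\<epsilon> * (a + 1) < K" using assms by (auto simp: less_divide_eq)
    \<comment> \<open>The base must be nonnegative for monotonicity of the power; hence the bound \<open>K / (a + 1)\<close> on \<open>\<epsilon>\<close>.\<close>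
    have "a \<le> K * inverse \<epsilon>" using \<epsilon> by (simp add: field_simps)
    then have nonneg: "0 \<le> q * (K * inverse \<epsilon> - a) + 1" using assms by simp
    \<comment> \<open>The summand \<open>1\<close> is absorbed into the leading term.\<close>
    have "1 \<le> q * inverse \<epsilon>" using \<epsilon> by (simp add: field_simps)
    moreover have "0 \<le> q * a" using assms by simp
    ultimately have "q * (K * inverse \<epsilon> - a) + 1 \<le> (K + 1) * (q * inverse \<epsilon>)"
      by (simp add: algebra_simps)
    then have "(q * (K * inverse \<epsilon> - a) + 1) powr r \<le> ((K + 1) * (q * inverse \<epsilon>)) powr r"
      using nonneg assms by (intro powr_mono2) auto
    also have "\<dots> = (K + 1) powr r * (q * inverse \<epsilon>) powr r" by (rule powr_mult)
    finally show ?case by simp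
  qed
qed

theorem theorem6:
  fixes f :: "real^'n \<Rightarrow> real" and g :: "real^'n \<Rightarrow> real^'n" and xstar :: "real^'n"
    and \<eta>1 \<eta>2 \<gamma>1 \<gamma>2 \<gamma>3 \<gamma>4 \<kappa>mdc \<alpha> \<beta> R L \<mu> p \<kappa>0 \<kappa>2 :: real
    and x :: "nat \<Rightarrow> real^'n" and B :: "nat \<Rightarrow> real^'n^'n" and t :: "nat \<Rightarrow> real"
    and s :: "nat \<Rightarrow> real^'n" and \<Delta> :: "nat \<Rightarrow> real"
    and S :: "nat set" and \<delta> :: "nat \<Rightarrow> real"
  assumes gradient: "\<And>y. GDERIV f y :> g y"
    and gradient_continuous: "continuous_on UNIV g"
    and convex: "convex_on UNIV f"
    and minimizer: "\<And>y. f xstar \<le> f y"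
    and R: "R \<ge> 1" "\<And>y. f y \<le> f (x 0) \<Longrightarrow> norm (y - xstar) \<le> R"
    and run: "trust_region_run f g \<eta>1 \<eta>2 \<gamma>1 \<gamma>2 \<gamma>3 \<gamma>4 \<kappa>mdc \<alpha> \<beta> x B t s \<Delta>"
    and L: "L \<ge> 1"
      "\<And>k. \<bar>f (x k + s k) - model f g (x k) (B k) (s k)\<bar> \<le> 1/2 * (L + mat_norm (B k)) * (norm (s k))\<^sup>2"
    and S_eq: "S = successful f g \<eta>1 x B s"
    and mu: "\<mu> > 0" and p: "0 \<le> p" "p \<le> 1"
    and B_growth: "\<And>k. Max ((\<lambda>j. mat_norm (B j)) ` {0..k})
          \<le> \<mu> * (1 + rpow (real (card {i \<in> S. i < k})) p)"
    and infinitely_many_successes: "infinite S"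
    and kappa0: "\<kappa>0 = psi L \<beta> (2 * \<mu>) / (\<eta>1 * \<kappa>mdc * a_min \<gamma>1 \<kappa>mdc \<eta>2 \<alpha> (\<Delta> 0) (g (x 0)))"
    and kappa2: "\<kappa>2 = psi L \<beta> (2 * \<mu>) / psi L \<beta> \<mu>"
    and delta: "\<And>k. \<delta> k = f (x k) - f xstar"
  shows "(p = 0 \<longrightarrow>
            (\<forall>\<epsilon>>0. (\<exists>k. crosses \<delta> \<epsilon> k) \<longrightarrow> real (card (S_hat S \<delta> \<epsilon>)) \<le> R\<^sup>2 * \<kappa>0 * inverse \<epsilon>)
          \<and> (\<lambda>\<epsilon>. R\<^sup>2 * \<kappa>0 * inverse \<epsilon>) \<in> O[at_right 0](\<lambda>\<epsilon>. inverse \<epsilon>)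
          \<and> (\<lambda>\<epsilon>. real (card (S_hat S \<delta> \<epsilon>))) \<in> O[at_right 0](\<lambda>\<epsilon>. inverse \<epsilon>))
       \<and> (0 < p \<and> p < 1 \<longrightarrow>
            (\<forall>\<epsilon>>0. (\<exists>k. crosses \<delta> \<epsilon> k) \<longrightarrow> real (card (S_hat S \<delta> \<epsilon>))
                \<le> ((1 - p) * (R\<^sup>2 * \<kappa>0 * inverse \<epsilon> - \<kappa>2) + 1) powr (1 / (1 - p)))
          \<and> (\<lambda>\<epsilon>. ((1 - p) * (R\<^sup>2 * \<kappa>0 * inverse \<epsilon> - \<kappa>2) + 1) powr (1 / (1 - p)))
                \<in> O[at_right 0](\<lambda>\<epsilon>. ((1 - p) * inverse \<epsilon>) powr (1 / (1 - p)))
          \<and> (\<lambda>\<epsilon>. real (card (S_hat S \<delta> \<epsilon>)))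
                \<in> O[at_right 0](\<lambda>\<epsilon>. ((1 - p) * inverse \<epsilon>) powr (1 / (1 - p))))
       \<and> (p = 1 \<longrightarrow>
            (\<forall>\<epsilon>>0. (\<exists>k. crosses \<delta> \<epsilon> k) \<longrightarrow>
              real (card (S_hat S \<delta> \<epsilon>)) \<le> exp (R\<^sup>2 * \<kappa>0 * inverse \<epsilon> - \<kappa>2)))"
proof -
  interpret trust_region_run f g \<eta>1 \<eta>2 \<gamma>1 \<gamma>2 \<gamma>3 \<gamma>4 \<kappa>mdc \<alpha> \<beta> x B t s \<Delta> by (rule run)
  interpret convex_trust_region_run f g \<eta>1 \<eta>2 \<gamma>1 \<gamma>2 \<gamma>3 \<gamma>4 \<kappa>mdc \<alpha> \<beta> x B t s \<Delta> xstar R L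
    using gradient convex minimizer R L infinitely_many_successes S_eq
    by unfold_locales auto
  have \<delta>_eq: "\<delta> = gap" using delta by (intro ext)
  have amin: "0 < amin" by (rule amin_pos[OF gnorm_pos])
  have psi2: "0 < psi L \<beta> (2 * \<mu>)" using mu by (intro psi_pos[OF L(1)]) auto
  have \<kappa>0: "0 < \<kappa>0" using psi2 amin eta kappa_mdc by (simp add: kappa0)
  have \<kappa>2: "0 \<le> \<kappa>2" using psi2 psi_pos[OF L(1), of \<mu> \<beta>] mu by (simp add: kappa2)
  have K: "0 < R\<^sup>2 * \<kappa>0" using \<kappa>0 R_pos by simp
  have sum_le: "(\<Sum>j<successes k. psi L \<beta> (2 * \<mu>) / psi L \<beta> (\<mu> * (1 + rpow (real j) p)))
      \<le> R\<^sup>2 * \<kappa>0 * inverse \<epsilon>" if "0 < \<epsilon>" "\<epsilon> < gap k" for \<epsilon> k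
    unfolding kappa0 using B_growth that by (intro sum_weights_le mu) (auto simp: S_eq)
  have power_sum_le: "\<kappa>2 + (\<Sum>j=1..<successes k. real j powr (- p)) \<le> R\<^sup>2 * \<kappa>0 * inverse \<epsilon>"
    if "0 < p" "1 \<le> successes k" "0 < \<epsilon>" "\<epsilon> < gap k" for \<epsilon> k
    unfolding kappa2 using sum_weights_ge[OF L(1) mu that(1,2)] sum_le[OF that(3,4)]
    by (rule order_trans)
  show ?thesis
  proof (intro conjI[of "_ \<longrightarrow> _"] impI)
    assume p0: "p = 0"
    have F: "real (successes k) \<le> R\<^sup>2 * \<kappa>0 * inverse \<epsilon>" if "0 < \<epsilon>" "\<epsilon> < gap k" for \<epsilon> k
      using sum_le[OF that] psi2 by (simp add: p0 rpow_def mult.commute)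
    have O: "(\<lambda>\<epsilon>. R\<^sup>2 * \<kappa>0 * inverse \<epsilon>) \<in> O[at_right 0](\<lambda>\<epsilon>. inverse \<epsilon>)"
      using K by simp
    show "(\<forall>\<epsilon>>0. (\<exists>k. crosses \<delta> \<epsilon> k) \<longrightarrow> real (card (S_hat S \<delta> \<epsilon>)) \<le> R\<^sup>2 * \<kappa>0 * inverse \<epsilon>)
          \<and> (\<lambda>\<epsilon>. R\<^sup>2 * \<kappa>0 * inverse \<epsilon>) \<in> O[at_right 0](\<lambda>\<epsilon>. inverse \<epsilon>)
          \<and> (\<lambda>\<epsilon>. real (card (S_hat S \<delta> \<epsilon>))) \<in> O[at_right 0](\<lambda>\<epsilon>. inverse \<epsilon>)"
      unfolding \<delta>_eq S_eq
      using S_hat_le[of "\<lambda>\<epsilon>. R\<^sup>2 * \<kappa>0 * inverse \<epsilon>", OF F] O S_hat_bigo[OF F O] by blast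
  next
    assume "0 < p \<and> p < 1"
    then have p01: "0 < p" "p < 1" by auto
    have F: "real (successes k)
        \<le> ((1 - p) * (R\<^sup>2 * \<kappa>0 * inverse \<epsilon> - \<kappa>2) + 1) powr (1 / (1 - p))"
      if \<epsilon>: "0 < \<epsilon>" "\<epsilon> < gap k" for \<epsilon> k
    proof (cases "1 \<le> successes k")
      case True
      let ?n = "real (successes k)"
      have "(?n powr (1 - p) - 1) / (1 - p) \<le> R\<^sup>2 * \<kappa>0 * inverse \<epsilon> - \<kappa>2"
        using powr_diff_le_sum[OF p01 True] power_sum_le[OF p01(1) True \<epsilon>] by linarith
      then have "?n powr (1 - p) \<le> (1 - p) * (R\<^sup>2 * \<kappa>0 * inverse \<epsilon> - \<kappa>2) + 1"
        using p01 by (simp add: pos_divide_le_eq mult.commute)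
      then have "(?n powr (1 - p)) powr (1 / (1 - p))
          \<le> ((1 - p) * (R\<^sup>2 * \<kappa>0 * inverse \<epsilon> - \<kappa>2) + 1) powr (1 / (1 - p))"
        using p01 by (intro powr_mono2) auto
      then show ?thesis using True p01 by (simp add: powr_powr)
    next
      \<comment> \<open>With no success so far, the sum has no first summand \<open>\<kappa>2\<close>, and the bound holds by its sign.\<close>
      case False
      then have "successes k = 0" by linarith
      then show ?thesis by (simp only: of_nat_0 powr_ge_zero)
    qed
    have O: "(\<lambda>\<epsilon>. ((1 - p) * (R\<^sup>2 * \<kappa>0 * inverse \<epsilon> - \<kappa>2) + 1) powr (1 / (1 - p)))
        \<in> O[at_right 0](\<lambda>\<epsilon>. ((1 - p) * inverse \<epsilon>) powr (1 / (1 - p)))"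
      using K \<kappa>2 p01 by (intro affine_powr_bigo) auto
    show "(\<forall>\<epsilon>>0. (\<exists>k. crosses \<delta> \<epsilon> k) \<longrightarrow> real (card (S_hat S \<delta> \<epsilon>))
                \<le> ((1 - p) * (R\<^sup>2 * \<kappa>0 * inverse \<epsilon> - \<kappa>2) + 1) powr (1 / (1 - p)))
          \<and> (\<lambda>\<epsilon>. ((1 - p) * (R\<^sup>2 * \<kappa>0 * inverse \<epsilon> - \<kappa>2) + 1) powr (1 / (1 - p)))
                \<in> O[at_right 0](\<lambda>\<epsilon>. ((1 - p) * inverse \<epsilon>) powr (1 / (1 - p)))
          \<and> (\<lambda>\<epsilon>. real (card (S_hat S \<delta> \<epsilon>)))
                \<in> O[at_right 0](\<lambda>\<epsilon>. ((1 - p) * inverse \<epsilon>) powr (1 / (1 - p)))"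
      unfolding \<delta>_eq S_eq
      using S_hat_le[of "\<lambda>\<epsilon>. ((1 - p) * (R\<^sup>2 * \<kappa>0 * inverse \<epsilon> - \<kappa>2) + 1) powr (1 / (1 - p))", OF F]
        O S_hat_bigo[OF F O] by blast
  next
    assume p1: "p = 1"
    have F: "real (successes k) \<le> exp (R\<^sup>2 * \<kappa>0 * inverse \<epsilon> - \<kappa>2)"
      if \<epsilon>: "0 < \<epsilon>" "\<epsilon> < gap k" for \<epsilon> k
    proof (cases "1 \<le> successes k")
      case True
      have "(\<Sum>j=1..<successes k. real j powr (- p)) = (\<Sum>j=1..<successes k. inverse (real j))"
        by (intro sum.cong) (auto simp: p1 powr_minus)
      then have "ln (real (successes k)) \<le> R\<^sup>2 * \<kappa>0 * inverse \<epsilon> - \<kappa>2"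
        using ln_le_sum_inverse[OF True] power_sum_le[OF _ True \<epsilon>] p1 by simp
      then have "exp (ln (real (successes k))) \<le> exp (R\<^sup>2 * \<kappa>0 * inverse \<epsilon> - \<kappa>2)" by simp
      then show ?thesis using True by simp
    next
      \<comment> \<open>With no success so far, the sum has no first summand \<open>\<kappa>2\<close>, and the bound holds by its sign.\<close>
      case False
      then have "successes k = 0" by linarith
      then show ?thesis by (simp only: of_nat_0 exp_ge_zero)
    qed
    show "\<forall>\<epsilon>>0. (\<exists>k. crosses \<delta> \<epsilon> k) \<longrightarrow>
              real (card (S_hat S \<delta> \<epsilon>)) \<le> exp (R\<^sup>2 * \<kappa>0 * inverse \<epsilon> - \<kappa>2)"
      unfolding \<delta>_eq S_eq
      using S_hat_le[of "\<lambda>\<epsilon>. exp (R\<^sup>2 * \<kappa>0 * inverse \<epsilon> - \<kappa>2)", OF F] by blast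
  qed
qed

end
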